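(* Every topological space $X$ has the same shape as its Hausdorff reflection $X_H$.
   Context: Hausdorff reflection: for a topological space $X$, let $R_3$ be the equivalence relation $x\,R_3\,y$ iff $f(x)=f(y)$ for every continuous map $f:X\to Z$ with $Z$ Hausdorff. Then $X_H=X/R_3$ with the quotient topology, and $\mu_X:X\to X_H$ is the quotient map; $X_H$ is Hausdorff and every continuous map from $X$ to a Hausdorff space factors continuously through $\mu_X$. Shape: the shape category of topological spaces is that of Mardešić–Segal; two spaces have the same shape if they are isomorphic in it. A continuous map $f:X\to Y$ induces an isomorphism in the shape category if and only if for every metric ANR $P$ (equivalently, every polyhedron or CW-complex $P$) the function $[Y,P]\to[X,P]$, $[h]\mapsto[h\circ f]$, on homotopy classes of continuous maps is a bijection. *)

theory Defs
  imports "HOL-Analysis.Analysis"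
begin

section \<open>The Hausdorff reflection\<close>

text \<open>
  The test spaces \<open>Z\<close> below live on the type of points of \<open>X\<close>. This is no restriction: only the
  image of \<open>X\<close> in \<open>Z\<close> matters, and it can be copied into the type of points of \<open>X\<close>. The lemma
  \<open>hausdorff_rel_imp_eq\<close> gives the statement for test spaces on an arbitrary type.
\<close>

definition hausdorff_rel :: "'a topology \<Rightarrow> ('a \<times> 'a) set" where
  "hausdorff_rel X =
     {(x, y). x \<in> topspace X \<and> y \<in> topspace X \<and>
        (\<forall>(Z :: 'a topology) f. Hausdorff_space Z \<and> continuous_map X Z f \<longrightarrow> f x = f y)}"

definition reflection_map :: "'a topology \<Rightarrow> 'a \<Rightarrow> 'a set" where
  "reflection_map X x = hausdorff_rel X `` {x}"

definition hausdorff_reflection :: "'a topology \<Rightarrow> 'a set topology" where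
  "hausdorff_reflection X =
     topology (\<lambda>V. V \<subseteq> topspace X // hausdorff_rel X \<and>
                   openin X {x \<in> topspace X. reflection_map X x \<in> V})"

lemma hausdorff_relI:
  fixes X :: "'a topology"
  assumes "x \<in> topspace X" "y \<in> topspace X"
    and "\<And>(Z :: 'a topology) f. Hausdorff_space Z \<Longrightarrow> continuous_map X Z f \<Longrightarrow> f x = f y"
  shows "(x, y) \<in> hausdorff_rel X"
  unfolding hausdorff_rel_def mem_Collect_eq split_conv
  by (intro conjI allI impI assms; elim conjE; assumption)

lemma hausdorff_relD:
  fixes X Z :: "'a topology"
  assumes "(x, y) \<in> hausdorff_rel X" and "Hausdorff_space Z" "continuous_map X Z f"
  shows "f x = f y"
  using assms(1)[unfolded hausdorff_rel_def mem_Collect_eq split_conv,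
      THEN conjunct2, THEN conjunct2, rule_format, OF conjI, OF assms(2,3)] .

lemma hausdorff_rel_topspace:
  assumes "(x, y) \<in> hausdorff_rel X"
  shows "x \<in> topspace X" "y \<in> topspace X"
  using assms unfolding hausdorff_rel_def by blast+

lemma equiv_hausdorff_rel: "equiv (topspace X) (hausdorff_rel X)"
proof (rule equivI)
  show "hausdorff_rel X \<subseteq> topspace X \<times> topspace X"
    using hausdorff_rel_topspace by fast
  show "refl_on (topspace X) (hausdorff_rel X)"
    by (rule refl_onI) (rule hausdorff_relI; simp)
  show "sym (hausdorff_rel X)"
  proof (rule symI)
    fix x y assume xy: "(x, y) \<in> hausdorff_rel X"
    show "(y, x) \<in> hausdorff_rel X"
    proof (rule hausdorff_relI)
      show "y \<in> topspace X" "x \<in> topspace X"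
        using xy by (auto dest: hausdorff_rel_topspace)
    next
      fix Z :: "'a topology" and f
      assume Zf: "Hausdorff_space Z" "continuous_map X Z f"
      show "f y = f x"
        by (rule hausdorff_relD[OF xy Zf, symmetric])
    qed
  qed
  show "trans (hausdorff_rel X)"
  proof (rule transI)
    fix x y z assume xy: "(x, y) \<in> hausdorff_rel X" and yz: "(y, z) \<in> hausdorff_rel X"
    show "(x, z) \<in> hausdorff_rel X"
    proof (rule hausdorff_relI)
      show "x \<in> topspace X" "z \<in> topspace X"
        using xy yz by (auto dest: hausdorff_rel_topspace)
    next
      fix Z :: "'a topology" and f
      assume Zf: "Hausdorff_space Z" "continuous_map X Z f"
      show "f x = f z"
        by (rule trans[OF hausdorff_relD[OF xy Zf] hausdorff_relD[OF yz Zf]])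
    qed
  qed
qed

lemma hausdorff_rel_imp_eq:
  fixes X :: "'a topology" and Z :: "'z topology"
  assumes xy: "(x, y) \<in> hausdorff_rel X"
    and Z: "Hausdorff_space Z" and f: "continuous_map X Z f"
  shows "f x = f y"
proof -
  define s where "s = inv_into (topspace X) f"
  define W where "W = pullback_topology (s ` f ` topspace X) f Z"
  have fs: "f (s z) = z" if "z \<in> f ` topspace X" for z
    using that by (auto simp: s_def f_inv_into_f)
  have tW: "topspace W \<subseteq> s ` f ` topspace X"
    by (auto simp: W_def topspace_pullback_topology)
  have "continuous_map W Z (id \<circ> f)"
    unfolding W_def by (rule continuous_map_pullback) simp
  then have "continuous_map W Z f"
    by simp
  moreover have "inj_on f (topspace W)"
    using tW fs by (intro inj_on_subset[OF inj_on_inverseI[where g = s]]) auto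
  ultimately have W: "Hausdorff_space W"
    using Z Hausdorff_space_injective_preimage by blast
  have sf: "continuous_map X W (s \<circ> f)"
    unfolding W_def
  proof (rule continuous_map_pullback')
    show "continuous_map X Z (f \<circ> (s \<circ> f))"
      by (rule continuous_map_eq[OF f]) (auto simp: fs)
    show "topspace X \<subseteq> (s \<circ> f) -` (s ` f ` topspace X)"
      by auto
  qed
  have "s (f x) = s (f y)"
    using hausdorff_relD[OF xy W sf] by simp
  moreover have "f (s (f x)) = f x" "f (s (f y)) = f y"
    by (rule fs[OF imageI[OF hausdorff_rel_topspace(1)[OF xy]]],
        rule fs[OF imageI[OF hausdorff_rel_topspace(2)[OF xy]]])
  ultimately show ?thesis
    by metis
qed

lemma openin_hausdorff_reflection:
  "openin (hausdorff_reflection X) V \<longleftrightarrow>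
     V \<subseteq> topspace X // hausdorff_rel X \<and> openin X {x \<in> topspace X. reflection_map X x \<in> V}"
proof -
  have "istopology (\<lambda>V. V \<subseteq> topspace X // hausdorff_rel X \<and>
                        openin X {x \<in> topspace X. reflection_map X x \<in> V})"
    (is "istopology ?L")
    unfolding istopology_def
  proof (intro conjI allI impI)
    fix S T assume S: "?L S" and T: "?L T"
    have "{x \<in> topspace X. reflection_map X x \<in> S \<inter> T} =
          {x \<in> topspace X. reflection_map X x \<in> S} \<inter> {x \<in> topspace X. reflection_map X x \<in> T}"
      by auto
    with S T show "openin X {x \<in> topspace X. reflection_map X x \<in> S \<inter> T}"
      by (simp add: openin_Int)
    show "S \<inter> T \<subseteq> topspace X // hausdorff_rel X" using S by auto
  next
    fix K assume K: "\<forall>S\<in>K. ?L S"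
    have "{x \<in> topspace X. reflection_map X x \<in> \<Union>K} =
          (\<Union>S\<in>K. {x \<in> topspace X. reflection_map X x \<in> S})"
      by auto
    with K show "openin X {x \<in> topspace X. reflection_map X x \<in> \<Union>K}"
      by auto
    show "\<Union>K \<subseteq> topspace X // hausdorff_rel X" using K by auto
  qed
  then show ?thesis
    by (simp add: hausdorff_reflection_def)
qed

lemma topspace_hausdorff_reflection:
  "topspace (hausdorff_reflection X) = topspace X // hausdorff_rel X"
proof
  show "topspace (hausdorff_reflection X) \<subseteq> topspace X // hausdorff_rel X"
    using openin_hausdorff_reflection openin_topspace by blast
  have "{x \<in> topspace X. reflection_map X x \<in> topspace X // hausdorff_rel X} = topspace X"
    by (auto simp: reflection_map_def quotientI)
  then show "topspace X // hausdorff_rel X \<subseteq> topspace (hausdorff_reflection X)"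
    by (intro openin_subset) (simp add: openin_hausdorff_reflection)
qed

lemma quotient_map_reflection_map:
  "quotient_map X (hausdorff_reflection X) (reflection_map X)"
proof -
  have "reflection_map X ` topspace X = topspace X // hausdorff_rel X"
    by (auto simp: reflection_map_def quotient_def)
  then show ?thesis
    by (auto simp: quotient_map_def topspace_hausdorff_reflection openin_hausdorff_reflection)
qed

lemma reflection_map_factor:
  fixes Z :: "'z topology"
  assumes Z: "Hausdorff_space Z" and f: "continuous_map X Z f"
  shows "\<exists>g. continuous_map (hausdorff_reflection X) Z g \<and>
             (\<forall>x\<in>topspace X. g (reflection_map X x) = f x)"
proof (rule quotient_map_lift_exists[OF quotient_map_reflection_map f])
  fix u v
  assume uv: "u \<in> topspace X" "v \<in> topspace X" "reflection_map X u = reflection_map X v"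
  have "(u, v) \<in> hausdorff_rel X"
    using eq_equiv_class[OF uv(3)[unfolded reflection_map_def] equiv_hausdorff_rel uv(2)] .
  then show "f u = f v"
    by (rule hausdorff_rel_imp_eq[OF _ Z f])
next
  fix g
  assume "continuous_map (hausdorff_reflection X) Z g"
    and "\<And>x. x \<in> topspace X \<Longrightarrow> g (reflection_map X x) = f x"
  then show "\<exists>g. continuous_map (hausdorff_reflection X) Z g \<and>
                 (\<forall>x\<in>topspace X. g (reflection_map X x) = f x)"
    by (intro exI[of _ g] conjI ballI)
qed

lemma Hausdorff_space_hausdorff_reflection: "Hausdorff_space (hausdorff_reflection X)"
  unfolding Hausdorff_space_def
proof (intro allI impI, elim conjE)
  fix a b
  assume a: "a \<in> topspace (hausdorff_reflection X)" and b: "b \<in> topspace (hausdorff_reflection X)"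
    and ne: "a \<noteq> b"
  obtain x where x: "x \<in> topspace X" "a = reflection_map X x"
    using a by (auto simp: topspace_hausdorff_reflection reflection_map_def elim!: quotientE)
  obtain y where y: "y \<in> topspace X" "b = reflection_map X y"
    using b by (auto simp: topspace_hausdorff_reflection reflection_map_def elim!: quotientE)
  have "(x, y) \<notin> hausdorff_rel X"
    using ne x(2) y(2) equiv_class_eq[OF equiv_hausdorff_rel, of x y X]
    unfolding reflection_map_def by metis
  then have "\<exists>(Z :: 'a topology) f. Hausdorff_space Z \<and> continuous_map X Z f \<and> f x \<noteq> f y"
    using x(1) y(1) by (simp add: hausdorff_rel_def)
  then show "\<exists>U V. openin (hausdorff_reflection X) U \<and> openin (hausdorff_reflection X) V \<and>
                   a \<in> U \<and> b \<in> V \<and> disjnt U V"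
  proof (elim exE conjE)
    fix Z :: "'a topology" and f
    assume Z: "Hausdorff_space Z" and f: "continuous_map X Z f" and fxy: "f x \<noteq> f y"
    obtain g where "continuous_map (hausdorff_reflection X) Z g \<and>
                    (\<forall>x\<in>topspace X. g (reflection_map X x) = f x)"
      using reflection_map_factor[OF Z f] by (rule exE)
    then have g: "continuous_map (hausdorff_reflection X) Z g"
      and gf: "\<forall>x\<in>topspace X. g (reflection_map X x) = f x"
      by (rule conjunct1, rule conjunct2)
    have "f x \<in> topspace Z" "f y \<in> topspace Z"
      using f x(1) y(1) by (auto simp: continuous_map_def)
    then obtain U V where UV: "openin Z U" "openin Z V" "f x \<in> U" "f y \<in> V" "disjnt U V"
      using Z fxy unfolding Hausdorff_space_def by blast
    let ?U = "{c \<in> topspace (hausdorff_reflection X). g c \<in> U}"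
    let ?V = "{c \<in> topspace (hausdorff_reflection X). g c \<in> V}"
    have "openin (hausdorff_reflection X) ?U" "openin (hausdorff_reflection X) ?V"
      using openin_continuous_map_preimage[OF g] UV(1,2) by auto
    moreover have "a \<in> ?U" "b \<in> ?V"
      using a b UV(3,4) bspec[OF gf x(1)] bspec[OF gf y(1)] x(2) y(2) by auto
    moreover have "disjnt ?U ?V"
      using UV(5) by (auto simp: disjnt_def)
    ultimately show "\<exists>U V. openin (hausdorff_reflection X) U \<and> openin (hausdorff_reflection X) V \<and>
                            a \<in> U \<and> b \<in> V \<and> disjnt U V"
      by (intro exI[of _ ?U] exI[of _ ?V] conjI)
  qed
qed


section \<open>The category HPol\<close>

abbreviation homotopic :: "'a topology \<Rightarrow> 'b topology \<Rightarrow> ('a \<Rightarrow> 'b) \<Rightarrow> ('a \<Rightarrow> 'b) \<Rightarrow> bool" where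
  "homotopic X Y f g \<equiv> homotopic_with (\<lambda>_. True) X Y f g"

text \<open>
  Absolute neighbourhood retracts for metrizable spaces. The ambient spaces \<open>M\<close> live on the type
  \<open>'u \<Rightarrow> real\<close>, which loses nothing: by Kuratowski and Wojdyslawski, \<open>P\<close> is homeomorphic to a closed
  subset of a convex set \<open>C\<close> of bounded functions \<open>'u \<Rightarrow> real\<close> with the sup metric; if \<open>P\<close> is a
  retract of a neighbourhood in \<open>C\<close>, then Dugundji's theorem makes it a neighbourhood retract of
  every metrizable space, on any type, that contains it as a closed subset.
\<close>

definition metric_ANR :: "'u topology \<Rightarrow> bool" where
  "metric_ANR P \<longleftrightarrow> metrizable_space P \<and>
     (\<forall>(M :: ('u \<Rightarrow> real) topology) S.
        metrizable_space M \<and> closedin M S \<and> subtopology M S homeomorphic_space P \<longrightarrow>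
        (\<exists>U. openin M U \<and> S \<subseteq> U \<and> S retract_of_space subtopology M U))"

text \<open>
  The objects of HPol are the spaces of the homotopy type of a metric ANR; these are the homotopy
  types of polyhedra and of CW-complexes. Its morphisms are homotopy classes of maps, which are
  represented by maps throughout.
\<close>

definition hpol_space :: "'u topology \<Rightarrow> bool" where
  "hpol_space P \<longleftrightarrow> (\<exists>A :: 'u topology. metric_ANR A \<and> P homotopy_equivalent_space A)"


section \<open>The category pro-HPol\<close>

record ('i, 'u) system =
  Idx :: "'i set"
  Le :: "'i \<Rightarrow> 'i \<Rightarrow> bool"
  Obj :: "'i \<Rightarrow> 'u topology"
  Bond :: "'i \<Rightarrow> 'i \<Rightarrow> 'u \<Rightarrow> 'u"  (* for i below j, Bond i j maps Obj j to Obj i *)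

text \<open>Inverse systems in HPol over directed preordered sets.\<close>

definition inverse_system :: "('i, 'u) system \<Rightarrow> bool" where
  "inverse_system \<X> \<longleftrightarrow>
     Idx \<X> \<noteq> {} \<and>
     (\<forall>i\<in>Idx \<X>. Le \<X> i i) \<and>
     (\<forall>i\<in>Idx \<X>. \<forall>j\<in>Idx \<X>. \<forall>k\<in>Idx \<X>. Le \<X> i j \<and> Le \<X> j k \<longrightarrow> Le \<X> i k) \<and>
     (\<forall>i\<in>Idx \<X>. \<forall>j\<in>Idx \<X>. \<exists>k\<in>Idx \<X>. Le \<X> i k \<and> Le \<X> j k) \<and>
     (\<forall>i\<in>Idx \<X>. hpol_space (Obj \<X> i)) \<and>
     (\<forall>i\<in>Idx \<X>. \<forall>j\<in>Idx \<X>. Le \<X> i j \<longrightarrow> continuous_map (Obj \<X> j) (Obj \<X> i) (Bond \<X> i j)) \<and>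
     (\<forall>i\<in>Idx \<X>. homotopic (Obj \<X> i) (Obj \<X> i) (Bond \<X> i i) id) \<and>
     (\<forall>i\<in>Idx \<X>. \<forall>j\<in>Idx \<X>. \<forall>k\<in>Idx \<X>. Le \<X> i j \<and> Le \<X> j k \<longrightarrow>
        homotopic (Obj \<X> k) (Obj \<X> i) (Bond \<X> i j \<circ> Bond \<X> j k) (Bond \<X> i k))"

text \<open>
  A morphism of inverse systems \<open>\<X> \<rightarrow> \<Y>\<close> is a pair \<open>F = (\<phi>, f)\<close> of a function \<open>\<phi>\<close> from the indices of
  \<open>\<Y>\<close> to those of \<open>\<X>\<close> and maps \<open>f m\<close> from the object of \<open>\<X>\<close> at \<open>\<phi> m\<close> to the object of \<open>\<Y>\<close> at \<open>m\<close>.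
  The morphisms of pro-HPol are the classes of such pairs modulo \<open>pro_eq\<close>.
\<close>

type_synonym ('i, 'j, 'u) premorphism = "('j \<Rightarrow> 'i) \<times> ('j \<Rightarrow> 'u \<Rightarrow> 'u)"

definition pro_map ::
    "('i, 'u) system \<Rightarrow> ('j, 'u) system \<Rightarrow> ('i, 'j, 'u) premorphism \<Rightarrow> bool" where
  "pro_map \<X> \<Y> F \<longleftrightarrow> (case F of (\<phi>, f) \<Rightarrow>
     (\<forall>m\<in>Idx \<Y>. \<phi> m \<in> Idx \<X> \<and> continuous_map (Obj \<X> (\<phi> m)) (Obj \<Y> m) (f m)) \<and>
     (\<forall>m\<in>Idx \<Y>. \<forall>n\<in>Idx \<Y>. Le \<Y> m n \<longrightarrow>
        (\<exists>l\<in>Idx \<X>. Le \<X> (\<phi> m) l \<and> Le \<X> (\<phi> n) l \<and>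
           homotopic (Obj \<X> l) (Obj \<Y> m)
             (f m \<circ> Bond \<X> (\<phi> m) l) (Bond \<Y> m n \<circ> f n \<circ> Bond \<X> (\<phi> n) l))))"

definition pro_eq ::
    "('i, 'u) system \<Rightarrow> ('j, 'u) system \<Rightarrow>
     ('i, 'j, 'u) premorphism \<Rightarrow> ('i, 'j, 'u) premorphism \<Rightarrow> bool" where
  "pro_eq \<X> \<Y> F G \<longleftrightarrow> (case (F, G) of ((\<phi>, f), (\<psi>, g)) \<Rightarrow>
     \<forall>m\<in>Idx \<Y>. \<exists>l\<in>Idx \<X>. Le \<X> (\<phi> m) l \<and> Le \<X> (\<psi> m) l \<and>
       homotopic (Obj \<X> l) (Obj \<Y> m) (f m \<circ> Bond \<X> (\<phi> m) l) (g m \<circ> Bond \<X> (\<psi> m) l))"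

definition pro_comp ::
    "('j, 'k, 'u) premorphism \<Rightarrow> ('i, 'j, 'u) premorphism \<Rightarrow> ('i, 'k, 'u) premorphism" where
  "pro_comp G F = (case (G, F) of ((\<psi>, g), (\<phi>, f)) \<Rightarrow> (\<phi> \<circ> \<psi>, \<lambda>n. g n \<circ> f (\<psi> n)))"

definition pro_id :: "('i, 'i, 'u) premorphism" where
  "pro_id = (id, \<lambda>_. id)"

definition pro_isomorphic :: "('i, 'u) system \<Rightarrow> ('j, 'u) system \<Rightarrow> bool" where
  "pro_isomorphic \<X> \<Y> \<longleftrightarrow>
     (\<exists>F G. pro_map \<X> \<Y> F \<and> pro_map \<Y> \<X> G \<and>
        pro_eq \<X> \<X> (pro_comp G F) pro_id \<and> pro_eq \<Y> \<Y> (pro_comp F G) pro_id)"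


section \<open>HPol-expansions and shape\<close>

text \<open>
  The first two definitions are the morphisms from a space to an inverse system (the space being
  regarded as a system indexed by a singleton) and the composition \<open>F \<circ> p\<close>. Two such morphisms are
  equal iff their components are homotopic.
\<close>

definition sys_cone :: "'a topology \<Rightarrow> ('i, 'u) system \<Rightarrow> ('i \<Rightarrow> 'a \<Rightarrow> 'u) \<Rightarrow> bool" where
  "sys_cone X \<Y> h \<longleftrightarrow>
     (\<forall>m\<in>Idx \<Y>. continuous_map X (Obj \<Y> m) (h m)) \<and>
     (\<forall>m\<in>Idx \<Y>. \<forall>n\<in>Idx \<Y>. Le \<Y> m n \<longrightarrow> homotopic X (Obj \<Y> m) (Bond \<Y> m n \<circ> h n) (h m))"

definition sys_cone_comp :: "('i, 'j, 'u) premorphism \<Rightarrow> ('i \<Rightarrow> 'a \<Rightarrow> 'u) \<Rightarrow> ('j \<Rightarrow> 'a \<Rightarrow> 'u)" where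
  "sys_cone_comp F p = (case F of (\<phi>, f) \<Rightarrow> \<lambda>m. f m \<circ> p (\<phi> m))"

definition sys_cone_eq ::
    "'a topology \<Rightarrow> ('i, 'u) system \<Rightarrow> ('i \<Rightarrow> 'a \<Rightarrow> 'u) \<Rightarrow> ('i \<Rightarrow> 'a \<Rightarrow> 'u) \<Rightarrow> bool" where
  "sys_cone_eq X \<Y> h h' \<longleftrightarrow> (\<forall>m\<in>Idx \<Y>. homotopic X (Obj \<Y> m) (h m) (h' m))"

definition hpol_expansion :: "'a topology \<Rightarrow> ('i, 'u) system \<Rightarrow> ('i \<Rightarrow> 'a \<Rightarrow> 'u) \<Rightarrow> bool" where
  "hpol_expansion X \<X> p \<longleftrightarrow>
     inverse_system \<X> \<and> sys_cone X \<X> p \<and>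
     (\<forall>(\<Y> :: ('i, 'u) system) h. inverse_system \<Y> \<and> sys_cone X \<Y> h \<longrightarrow>
        (\<exists>F. pro_map \<X> \<Y> F \<and> sys_cone_eq X \<Y> (sys_cone_comp F p) h \<and>
           (\<forall>G. pro_map \<X> \<Y> G \<and> sys_cone_eq X \<Y> (sys_cone_comp G p) h \<longrightarrow> pro_eq \<X> \<Y> F G)))"

text \<open>
  A shape morphism \<open>X \<rightarrow> Y\<close> is a morphism of pro-HPol between chosen HPol-expansions of \<open>X\<close> and \<open>Y\<close>,
  so \<open>X\<close> and \<open>Y\<close> are isomorphic in the shape category iff their HPol-expansions are isomorphic in
  pro-HPol. As expansions are unique up to isomorphism, the choice does not matter, and \<open>same_shape\<close>
  asks for an isomorphism for every choice.

  Since a HOL formula cannot quantify over types, HPol is taken in a universe: \<open>'u\<close> is the type of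
  points of its objects, \<open>'i\<close> the type of indices of inverse systems. By the existence theorem for
  HPol-expansions every space on a type \<open>'a\<close> has one as soon as \<open>'u\<close> and \<open>'i\<close> are large enough
  relative to \<open>'a\<close>, and if \<open>'u\<close> has at least the cardinality of \<open>'a\<close> and of the continuum then such
  expansions are expansions with respect to the whole of HPol. The first conjunct makes the
  definition meaningful in every universe: either both spaces have HPol-expansions, and these are
  all isomorphic, or neither does.
\<close>

definition same_shape :: "('u \<times> 'i) itself \<Rightarrow> 'a topology \<Rightarrow> 'b topology \<Rightarrow> bool" where
  "same_shape _ X Y \<longleftrightarrow>
     ((\<exists>(\<X> :: ('i, 'u) system) p. hpol_expansion X \<X> p) \<longleftrightarrow>
      (\<exists>(\<Y> :: ('i, 'u) system) q. hpol_expansion Y \<Y> q)) \<and>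
     (\<forall>(\<X> :: ('i, 'u) system) p (\<Y> :: ('i, 'u) system) q.
        hpol_expansion X \<X> p \<and> hpol_expansion Y \<Y> q \<longrightarrow> pro_isomorphic \<X> \<Y>)"

text \<open>
  A space in HPol is its own HPol-expansion, so two such spaces of the same shape are homotopy
  equivalent.
\<close>

definition constant_system :: "'i \<Rightarrow> 'u topology \<Rightarrow> ('i, 'u) system" where
  "constant_system i P =
     \<lparr>Idx = {i}, Le = (\<lambda>_ _. True), Obj = (\<lambda>_. P), Bond = (\<lambda>_ _. id)\<rparr>"

lemma hpol_expansion_constant_system:
  assumes "hpol_space P"
  shows "hpol_expansion P (constant_system i P) (\<lambda>_. id)"
  unfolding hpol_expansion_def
proof (intro conjI allI impI)
  show "inverse_system (constant_system i P)"
    using assms by (simp add: inverse_system_def constant_system_def)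
  show "sys_cone P (constant_system i P) (\<lambda>_. id)"
    by (simp add: sys_cone_def constant_system_def)
next
  fix \<Y> :: "('b, 'a) system" and h
  assume Y: "inverse_system \<Y> \<and> sys_cone P \<Y> h"
  have 1: "pro_map (constant_system i P) \<Y> (\<lambda>_. i, h)"
    using Y by (auto simp: pro_map_def constant_system_def sys_cone_def homotopic_with_sym)
  have 2: "sys_cone_eq P \<Y> (sys_cone_comp (\<lambda>_. i, h) (\<lambda>_. id)) h"
    using Y by (auto simp: sys_cone_eq_def sys_cone_comp_def sys_cone_def)
  have 3: "pro_eq (constant_system i P) \<Y> (\<lambda>_. i, h) G"
    if G: "sys_cone_eq P \<Y> (sys_cone_comp G (\<lambda>_. id)) h" for G
    using G by (cases G)
      (auto simp: pro_eq_def constant_system_def sys_cone_eq_def sys_cone_comp_def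
        homotopic_with_sym)
  show "\<exists>F. pro_map (constant_system i P) \<Y> F \<and> sys_cone_eq P \<Y> (sys_cone_comp F (\<lambda>_. id)) h \<and>
            (\<forall>G. pro_map (constant_system i P) \<Y> G \<and>
                 sys_cone_eq P \<Y> (sys_cone_comp G (\<lambda>_. id)) h \<longrightarrow>
                 pro_eq (constant_system i P) \<Y> F G)"
    using 1 2 3 by blast
qed

lemma same_shape_imp_homotopy_equivalent:
  fixes P Q :: "'u topology"
  assumes "hpol_space P" "hpol_space Q" "same_shape TYPE('u \<times> 'i) P Q"
  shows "P homotopy_equivalent_space Q"
proof -
  fix i :: 'i
  have "pro_isomorphic (constant_system i P) (constant_system i Q)"
    using assms(3)[unfolded same_shape_def, THEN conjunct2, rule_format, OF conjI,
        OF hpol_expansion_constant_system[OF assms(1)] hpol_expansion_constant_system[OF assms(2)]] .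
  then obtain F G where FG:
    "pro_map (constant_system i P) (constant_system i Q) F"
    "pro_map (constant_system i Q) (constant_system i P) G"
    "pro_eq (constant_system i P) (constant_system i P) (pro_comp G F) pro_id"
    "pro_eq (constant_system i Q) (constant_system i Q) (pro_comp F G) pro_id"
    unfolding pro_isomorphic_def by (elim exE conjE)
  obtain \<phi> f \<psi> g where "F = (\<phi>, f)" "G = (\<psi>, g)"
    by (meson surj_pair)
  with FG have "continuous_map P Q (f i)" "continuous_map Q P (g i)"
    "homotopic P P (g i \<circ> f i) id" "homotopic Q Q (f i \<circ> g i) id"
    by (simp_all add: pro_map_def pro_eq_def pro_comp_def pro_id_def constant_system_def)
  then show ?thesis
    unfolding homotopy_equivalent_space_def by (intro exI[of _ "f i"] exI[of _ "g i"] conjI)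
qed

end

theory Submission
  imports Defs
begin

text \<open>
  A metric ANR is Hausdorff, and for every Hausdorff space \<open>A\<close> the reflection map
  \<open>\<mu> : X \<rightarrow> X\<^sub>H\<close> induces a bijection \<open>[X\<^sub>H, A] \<rightarrow> [X, A]\<close> of homotopy classes. Surjectivity is the
  universal property of the reflection. For injectivity, every stage of a homotopy
  \<open>X \<times> [0,1] \<rightarrow> A\<close> is constant on the fibres of \<open>\<mu>\<close>, so the homotopy factors through
  \<open>\<mu> \<times> id : X \<times> [0,1] \<rightarrow> X\<^sub>H \<times> [0,1]\<close>, and the factor is continuous because the product of a
  quotient map with the identity of a compact Hausdorff space is again a quotient map
  (\<open>hausdorff_reflection_homotopy_descends\<close>). The bijection carries over to every target that is
  homotopy equivalent to a metric ANR, that is, to all objects of HPol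
  (\<open>hpol_equivalence_reflection_map\<close>).

  Whether a cone is an HPol-expansion is a matter of homotopy classes of maps to objects of HPol.
  Composition with \<open>\<mu>\<close> therefore turns the expansions of \<open>X\<^sub>H\<close> into those of \<open>X\<close>, over the same
  inverse systems (\<open>hpol_expansion_iff\<close>). Hence one space has an expansion iff the other has, and any
  two expansions, one of each space, become expansions of \<open>X\<close>; these are isomorphic by the usual
  argument for solutions of a universal problem (\<open>hpol_expansions_pro_isomorphic\<close>).
\<close>

section \<open>Homotopies out of the Hausdorff reflection\<close>

lemma continuous_map_reflection_map:
  "continuous_map X (hausdorff_reflection X) (reflection_map X)"
  by (rule quotient_imp_continuous_map[OF quotient_map_reflection_map])

lemma reflection_map_eq_imp_eq:
  fixes X :: "'a topology" and Z :: "'z topology"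
  assumes "x \<in> topspace X" "y \<in> topspace X" "reflection_map X x = reflection_map X y"
    and "Hausdorff_space Z" "continuous_map X Z f"
  shows "f x = f y"
proof -
  have "(x, y) \<in> hausdorff_rel X"
    using eq_equiv_class[OF assms(3)[unfolded reflection_map_def] equiv_hausdorff_rel assms(2)] .
  then show ?thesis
    using assms(4,5) by (rule hausdorff_rel_imp_eq)
qed

text \<open>
  This is where the unit interval has to be locally compact: a product of a quotient map with the
  identity of an arbitrary space need not be a quotient map.
\<close>

lemma hausdorff_reflection_homotopy_descends:
  fixes X :: "'a topology" and Z :: "'z topology"
  assumes Z: "Hausdorff_space Z"
    and hom: "homotopic X Z (f \<circ> reflection_map X) (g \<circ> reflection_map X)"
  shows "homotopic (hausdorff_reflection X) Z f g"
proof -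
  let ?I = "top_of_set {0..1::real}" and ?\<mu> = "reflection_map X"
  obtain h where h: "continuous_map (prod_topology ?I X) Z h"
    and h0: "\<And>x. h (0, x) = f (?\<mu> x)" and h1: "\<And>x. h (1, x) = g (?\<mu> x)"
    using hom by (auto simp: homotopic_with_def)
  have quotient: "quotient_map (prod_topology ?I X) (prod_topology ?I (hausdorff_reflection X))
          (\<lambda>(t, x). (t, ?\<mu> x))"
    by (intro quotient_map_prod_right quotient_map_reflection_map disjI1
        compact_imp_locally_compact_space Hausdorff_space_subtopology)
      (simp_all add: compact_space_subtopology)
  have h_fibres: "h u = h v"
    if "u \<in> topspace (prod_topology ?I X)" "v \<in> topspace (prod_topology ?I X)"
      and eq: "(\<lambda>(t, x). (t, ?\<mu> x)) u = (\<lambda>(t, x). (t, ?\<mu> x)) v" for u v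
  proof -
    obtain t x y where uv: "u = (t, x)" "v = (t, y)" "?\<mu> x = ?\<mu> y"
      using eq by (cases u; cases v) auto
    then have t: "t \<in> topspace ?I" and x: "x \<in> topspace X" and y: "y \<in> topspace X"
      using that by auto
    have "(h \<circ> Pair t) x = (h \<circ> Pair t) y"
      by (rule reflection_map_eq_imp_eq[OF x y uv(3) Z continuous_map_o_Pair[OF h t]])
    then show ?thesis
      by (simp add: uv)
  qed
  obtain k where
    k: "continuous_map (prod_topology ?I (hausdorff_reflection X)) Z k"
    and kh: "\<And>u. u \<in> topspace (prod_topology ?I X) \<Longrightarrow> k ((\<lambda>(t, x). (t, ?\<mu> x)) u) = h u"
  proof (rule quotient_map_lift_exists[OF quotient h])
  qed (rule h_fibres, assumption+, rule that)
  have k_\<mu>: "k (t, ?\<mu> x) = h (t, x)" if "t \<in> {0..1}" "x \<in> topspace X" for t x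
    using kh[of "(t, x)"] that by simp
  have onto: "topspace (hausdorff_reflection X) = ?\<mu> ` topspace X"
    using quotient_imp_surjective_map[OF quotient_map_reflection_map] by metis
  have "homotopic (hausdorff_reflection X) Z f g \<longleftrightarrow>
      (\<exists>h. continuous_map (prod_topology ?I (hausdorff_reflection X)) Z h \<and>
        (\<forall>c\<in>topspace (hausdorff_reflection X). h (0, c) = f c) \<and>
        (\<forall>c\<in>topspace (hausdorff_reflection X). h (1, c) = g c) \<and> (\<forall>t\<in>{0..1::real}. True))"
    by (rule homotopic_with) simp
  then show ?thesis
    using k by (auto simp: onto k_\<mu> h0 h1)
qed


section \<open>Maps inducing bijections on homotopy classes\<close>

text \<open>
  These are the maps that induce shape isomorphisms, with HPol taken in the universe \<open>'u\<close>: \<open>lift\<close> is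
  the surjectivity and \<open>cancel\<close> the injectivity of \<open>[Y, P] \<rightarrow> [X, P]\<close>.
\<close>

locale hpol_equivalence =
  fixes X :: "'a topology" and Y :: "'b topology" and \<mu> :: "'a \<Rightarrow> 'b"
  assumes cont: "continuous_map X Y \<mu>"
    and lift: "\<lbrakk>hpol_space (P :: 'u topology); continuous_map X P f\<rbrakk> \<Longrightarrow>
      \<exists>g. continuous_map Y P g \<and> homotopic X P (g \<circ> \<mu>) f"
    and cancel: "\<lbrakk>hpol_space (P :: 'u topology); continuous_map Y P g; continuous_map Y P g';
        homotopic X P (g \<circ> \<mu>) (g' \<circ> \<mu>)\<rbrakk> \<Longrightarrow> homotopic Y P g g'"

text \<open>
  Objects of HPol need not be Hausdorff themselves, so the passage to a homotopy equivalent
  metric ANR is needed even for the surjectivity.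
\<close>

lemma hpol_equivalence_reflection_map:
  fixes X :: "'a topology"
  shows "hpol_equivalence TYPE('u) X (hausdorff_reflection X) (reflection_map X)"
proof
  let ?Y = "hausdorff_reflection X" and ?\<mu> = "reflection_map X"
  show "continuous_map X ?Y ?\<mu>"
    by (rule continuous_map_reflection_map)
  fix P :: "'u topology"
  assume "hpol_space P"
  then obtain A :: "'u topology" and a b where A: "metric_ANR A"
    and a: "continuous_map P A a" and b: "continuous_map A P b"
    and ba: "homotopic P P (b \<circ> a) id"
    by (auto simp: hpol_space_def homotopy_equivalent_space_def)
  have Hausdorff: "Hausdorff_space A"
    using A by (auto simp: metric_ANR_def intro: metrizable_imp_Hausdorff_space)
  have ba_comp: "homotopic W P (b \<circ> (a \<circ> f)) f" if "continuous_map W P f" for W :: "'w topology" and f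
    using homotopic_with_compose_continuous_map_right[OF ba that] by (simp add: o_assoc)
  {
    fix f
    assume f: "continuous_map X P f"
    obtain g where g: "continuous_map ?Y A g" and gf: "\<And>x. x \<in> topspace X \<Longrightarrow> g (?\<mu> x) = a (f x)"
      using reflection_map_factor[OF Hausdorff continuous_map_compose[OF f a]] by auto
    have "homotopic X P (b \<circ> g \<circ> ?\<mu>) (b \<circ> (a \<circ> f))"
      using continuous_map_compose[OF continuous_map_compose[OF continuous_map_reflection_map g] b]
      by (intro homotopic_with_equal) (auto simp: gf o_assoc)
    then have "homotopic X P (b \<circ> g \<circ> ?\<mu>) f"
      using ba_comp[OF f] by (rule homotopic_with_trans)
    then show "\<exists>g. continuous_map ?Y P g \<and> homotopic X P (g \<circ> ?\<mu>) f"
      using continuous_map_compose[OF g b] by blast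
  next
    fix g g'
    assume g: "continuous_map ?Y P g" and g': "continuous_map ?Y P g'"
      and "homotopic X P (g \<circ> ?\<mu>) (g' \<circ> ?\<mu>)"
    then have "homotopic X A (a \<circ> (g \<circ> ?\<mu>)) (a \<circ> (g' \<circ> ?\<mu>))"
      using a by (auto intro: homotopic_with_compose_continuous_map_left)
    then have "homotopic ?Y A (a \<circ> g) (a \<circ> g')"
      by (intro hausdorff_reflection_homotopy_descends[OF Hausdorff]) (simp add: o_assoc)
    then have "homotopic ?Y P (b \<circ> (a \<circ> g)) (b \<circ> (a \<circ> g'))"
      using b by (auto intro: homotopic_with_compose_continuous_map_left)
    then show "homotopic ?Y P g g'"
      using ba_comp[OF g] ba_comp[OF g'] by (meson homotopic_with_trans homotopic_with_symD)
  }
qed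


section \<open>Transport of HPol-expansions\<close>

lemma inverse_system_hpol_space:
  assumes "inverse_system \<Y>" "m \<in> Idx \<Y>"
  shows "hpol_space (Obj \<Y> m)"
proof -
  have "\<forall>m\<in>Idx \<Y>. hpol_space (Obj \<Y> m)"
    using assms(1) unfolding inverse_system_def by (elim conjE)
  then show ?thesis
    using assms(2-) by blast
qed

lemma inverse_system_Bond:
  assumes "inverse_system \<Y>" "m \<in> Idx \<Y>" "n \<in> Idx \<Y>" "Le \<Y> m n"
  shows "continuous_map (Obj \<Y> n) (Obj \<Y> m) (Bond \<Y> m n)"
proof -
  have "\<forall>m\<in>Idx \<Y>. \<forall>n\<in>Idx \<Y>. Le \<Y> m n \<longrightarrow>
      continuous_map (Obj \<Y> n) (Obj \<Y> m) (Bond \<Y> m n)"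
    using assms(1) unfolding inverse_system_def by (elim conjE)
  then show ?thesis
    using assms(2-) by blast
qed

lemma sys_cone_eq_sym: "sys_cone_eq X \<Y> h h' \<Longrightarrow> sys_cone_eq X \<Y> h' h"
  by (auto simp: sys_cone_eq_def intro: homotopic_with_symD)

lemma sys_cone_eq_trans:
  "\<lbrakk>sys_cone_eq X \<Y> h h'; sys_cone_eq X \<Y> h' h''\<rbrakk> \<Longrightarrow> sys_cone_eq X \<Y> h h''"
  unfolding sys_cone_eq_def by (meson homotopic_with_trans)

lemma pro_map_component:
  assumes "pro_map \<X> \<Y> (\<phi>, f)" "m \<in> Idx \<Y>"
  shows "\<phi> m \<in> Idx \<X>" "continuous_map (Obj \<X> (\<phi> m)) (Obj \<Y> m) (f m)"
  using assms by (simp_all add: pro_map_def)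

lemma sys_cone_comp_cong:
  assumes F: "pro_map \<X> \<Y> F" and p: "sys_cone_eq X \<X> p p'"
  shows "sys_cone_eq X \<Y> (sys_cone_comp F p) (sys_cone_comp F p')"
proof -
  obtain \<phi> f where "F = (\<phi>, f)"
    by fastforce
  with F p show ?thesis
    by (auto simp: sys_cone_eq_def sys_cone_comp_def pro_map_def
        intro!: homotopic_with_compose_continuous_map_left)
qed

lemma continuous_map_sys_cone_comp:
  assumes F: "pro_map \<X> \<Y> F" and q: "\<And>i. i \<in> Idx \<X> \<Longrightarrow> continuous_map Y (Obj \<X> i) (q i)"
    and m: "m \<in> Idx \<Y>"
  shows "continuous_map Y (Obj \<Y> m) (sys_cone_comp F q m)"
proof -
  obtain \<phi> f where F_eq: "F = (\<phi>, f)"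
    by fastforce
  have "continuous_map Y (Obj \<Y> m) (f m \<circ> q (\<phi> m))"
    using q[OF pro_map_component(1)[OF F[unfolded F_eq] m]] pro_map_component(2)[OF F[unfolded F_eq] m]
    by (rule continuous_map_compose)
  then show ?thesis
    by (simp add: F_eq sys_cone_comp_def)
qed

lemma sys_cone_comp_precomp:
  "sys_cone_comp F (\<lambda>i. q i \<circ> \<mu>) = (\<lambda>m. sys_cone_comp F q m \<circ> \<mu>)"
  by (cases F) (simp add: sys_cone_comp_def o_assoc)

context hpol_equivalence
begin

lemma homotopic_precomp_iff:
  assumes "hpol_space (P :: 'u topology)" "continuous_map Y P g" "continuous_map Y P g'"
  shows "homotopic X P (g \<circ> \<mu>) (g' \<circ> \<mu>) \<longleftrightarrow> homotopic Y P g g'"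
proof
  show "homotopic Y P g g'" if "homotopic X P (g \<circ> \<mu>) (g' \<circ> \<mu>)"
    using cancel[OF assms that] .
  show "homotopic X P (g \<circ> \<mu>) (g' \<circ> \<mu>)" if "homotopic Y P g g'"
    using that cont by (rule homotopic_with_compose_continuous_map_right) simp
qed

lemma sys_cone_eq_precomp_iff:
  fixes \<Y> :: "('i, 'u) system"
  assumes "inverse_system \<Y>"
    and "\<And>m. m \<in> Idx \<Y> \<Longrightarrow> continuous_map Y (Obj \<Y> m) (h m)"
    and "\<And>m. m \<in> Idx \<Y> \<Longrightarrow> continuous_map Y (Obj \<Y> m) (h' m)"
  shows "sys_cone_eq X \<Y> (\<lambda>m. h m \<circ> \<mu>) (\<lambda>m. h' m \<circ> \<mu>) \<longleftrightarrow> sys_cone_eq Y \<Y> h h'"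
  using assms by (simp add: sys_cone_eq_def homotopic_precomp_iff inverse_system_hpol_space)

lemma continuous_family_lift:
  fixes \<Y> :: "('i, 'u) system"
  assumes "inverse_system \<Y>" "sys_cone X \<Y> h"
  obtains h' where "\<And>m. m \<in> Idx \<Y> \<Longrightarrow> continuous_map Y (Obj \<Y> m) (h' m)"
    "sys_cone_eq X \<Y> (\<lambda>m. h' m \<circ> \<mu>) h"
proof -
  have "\<exists>g. continuous_map Y (Obj \<Y> m) g \<and> homotopic X (Obj \<Y> m) (g \<circ> \<mu>) (h m)"
    if m: "m \<in> Idx \<Y>" for m
    using assms(2) m by (intro lift inverse_system_hpol_space[OF assms(1) m]) (simp add: sys_cone_def)
  then obtain h' where "\<And>m. m \<in> Idx \<Y> \<Longrightarrow> continuous_map Y (Obj \<Y> m) (h' m) \<and>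
      homotopic X (Obj \<Y> m) (h' m \<circ> \<mu>) (h m)"
    by metis
  then show ?thesis
    by (intro that[of h']) (simp_all add: sys_cone_eq_def)
qed

lemma sys_cone_precomp_iff:
  fixes \<Y> :: "('i, 'u) system"
  assumes \<Y>: "inverse_system \<Y>"
    and h': "\<And>m. m \<in> Idx \<Y> \<Longrightarrow> continuous_map Y (Obj \<Y> m) (h' m)"
    and eq: "sys_cone_eq X \<Y> (\<lambda>m. h' m \<circ> \<mu>) h"
  shows "sys_cone X \<Y> h \<longleftrightarrow> sys_cone Y \<Y> h'"
proof -
  have hom: "homotopic X (Obj \<Y> m) (h' m \<circ> \<mu>) (h m)" if "m \<in> Idx \<Y>" for m
    using eq that by (simp add: sys_cone_eq_def)
  have "homotopic X (Obj \<Y> m) (Bond \<Y> m n \<circ> h n) (h m) \<longleftrightarrow>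
      homotopic Y (Obj \<Y> m) (Bond \<Y> m n \<circ> h' n) (h' m)"
    if m: "m \<in> Idx \<Y>" and n: "n \<in> Idx \<Y>" and le: "Le \<Y> m n" for m n
  proof -
    note Bond = inverse_system_Bond[OF \<Y> m n le]
    have "homotopic X (Obj \<Y> m) (Bond \<Y> m n \<circ> (h' n \<circ> \<mu>)) (Bond \<Y> m n \<circ> h n)"
      using hom[OF n] Bond by (auto intro: homotopic_with_compose_continuous_map_left)
    then have "homotopic X (Obj \<Y> m) (Bond \<Y> m n \<circ> h n) (h m) \<longleftrightarrow>
        homotopic X (Obj \<Y> m) (Bond \<Y> m n \<circ> h' n \<circ> \<mu>) (h' m \<circ> \<mu>)"
      using hom[OF m] unfolding o_assoc by (meson homotopic_with_trans homotopic_with_symD)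
    also have "\<dots> \<longleftrightarrow> homotopic Y (Obj \<Y> m) (Bond \<Y> m n \<circ> h' n) (h' m)"
      using inverse_system_hpol_space[OF \<Y> m] continuous_map_compose[OF h'[OF n] Bond] h'[OF m]
      by (rule homotopic_precomp_iff)
    finally show ?thesis .
  qed
  moreover have "continuous_map X (Obj \<Y> m) (h m)" if "m \<in> Idx \<Y>" for m
    using homotopic_with_imp_continuous_maps[OF hom[OF that]] by blast
  ultimately show ?thesis
    using h' by (simp add: sys_cone_def)
qed

text \<open>
  The universal property of \<open>p\<close> with respect to a cone \<open>h\<close> on \<open>X\<close> is that of \<open>q\<close> with respect to the
  cone \<open>h'\<close> on \<open>Y\<close> with \<open>h' \<circ> \<mu> \<simeq> h\<close>, since the same morphisms of systems solve both problems.
  Every cone on \<open>X\<close> arises in this way up to homotopy, and so does every cone on \<open>Y\<close>.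
\<close>

lemma hpol_expansion_iff:
  fixes \<X> :: "('i, 'u) system"
  assumes q: "\<And>i. i \<in> Idx \<X> \<Longrightarrow> continuous_map Y (Obj \<X> i) (q i)"
    and qp: "sys_cone_eq X \<X> (\<lambda>i. q i \<circ> \<mu>) p"
  shows "hpol_expansion X \<X> p \<longleftrightarrow> hpol_expansion Y \<X> q"
proof -
  define solvable where "solvable = (\<lambda>(\<Y> :: ('i, 'u) system) S.
    \<exists>F. pro_map \<X> \<Y> F \<and> S F \<and> (\<forall>G. pro_map \<X> \<Y> G \<and> S G \<longrightarrow> pro_eq \<X> \<Y> F G))"
  have solvable_iff: "solvable \<Y> (\<lambda>F. sys_cone_eq X \<Y> (sys_cone_comp F p) h) \<longleftrightarrow>
      solvable \<Y> (\<lambda>F. sys_cone_eq Y \<Y> (sys_cone_comp F q) h')"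
    if \<Y>: "inverse_system \<Y>"
      and h': "\<And>m. m \<in> Idx \<Y> \<Longrightarrow> continuous_map Y (Obj \<Y> m) (h' m)"
      and h'h: "sys_cone_eq X \<Y> (\<lambda>m. h' m \<circ> \<mu>) h" for \<Y> :: "('i, 'u) system" and h h'
  proof -
    have "sys_cone_eq X \<Y> (sys_cone_comp F p) h \<longleftrightarrow> sys_cone_eq Y \<Y> (sys_cone_comp F q) h'"
      if F: "pro_map \<X> \<Y> F" for F
    proof -
      have "sys_cone_eq X \<Y> (\<lambda>m. sys_cone_comp F q m \<circ> \<mu>) (sys_cone_comp F p)"
        using sys_cone_comp_cong[OF F qp] by (simp add: sys_cone_comp_precomp)
      then have "sys_cone_eq X \<Y> (sys_cone_comp F p) h \<longleftrightarrow>
          sys_cone_eq X \<Y> (\<lambda>m. sys_cone_comp F q m \<circ> \<mu>) (\<lambda>m. h' m \<circ> \<mu>)"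
        using h'h by (meson sys_cone_eq_sym sys_cone_eq_trans)
      also have "\<dots> \<longleftrightarrow> sys_cone_eq Y \<Y> (sys_cone_comp F q) h'"
        using \<Y> continuous_map_sys_cone_comp[OF F q] h' by (rule sys_cone_eq_precomp_iff)
      finally show ?thesis .
    qed
    then show ?thesis
      unfolding solvable_def by blast
  qed
  have "(\<forall>\<Y> h. inverse_system \<Y> \<and> sys_cone X \<Y> h \<longrightarrow>
          solvable \<Y> (\<lambda>F. sys_cone_eq X \<Y> (sys_cone_comp F p) h)) \<longleftrightarrow>
      (\<forall>\<Y> h'. inverse_system \<Y> \<and> sys_cone Y \<Y> h' \<longrightarrow>
          solvable \<Y> (\<lambda>F. sys_cone_eq Y \<Y> (sys_cone_comp F q) h'))" (is "?L \<longleftrightarrow> ?R")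
  proof (intro iffI allI impI; elim conjE)
    fix \<Y> :: "('i, 'u) system" and h'
    assume L: ?L and \<Y>: "inverse_system \<Y>" and cone: "sys_cone Y \<Y> h'"
    have h': "continuous_map Y (Obj \<Y> m) (h' m)" if "m \<in> Idx \<Y>" for m
      using cone that by (simp add: sys_cone_def)
    then have refl: "sys_cone_eq X \<Y> (\<lambda>m. h' m \<circ> \<mu>) (\<lambda>m. h' m \<circ> \<mu>)"
      using cont by (auto simp: sys_cone_eq_def intro: continuous_map_compose)
    show "solvable \<Y> (\<lambda>F. sys_cone_eq Y \<Y> (sys_cone_comp F q) h')"
      using L \<Y> cone sys_cone_precomp_iff[OF \<Y> h' refl] solvable_iff[OF \<Y> h' refl] by blast
  next
    fix \<Y> :: "('i, 'u) system" and h
    assume R: ?R and \<Y>: "inverse_system \<Y>" and cone: "sys_cone X \<Y> h"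
    obtain h' where h': "\<And>m. m \<in> Idx \<Y> \<Longrightarrow> continuous_map Y (Obj \<Y> m) (h' m)"
      and h'h: "sys_cone_eq X \<Y> (\<lambda>m. h' m \<circ> \<mu>) h"
      by (rule continuous_family_lift[OF \<Y> cone]) blast
    show "solvable \<Y> (\<lambda>F. sys_cone_eq X \<Y> (sys_cone_comp F p) h)"
      using R \<Y> cone sys_cone_precomp_iff[OF \<Y> h' h'h] solvable_iff[OF \<Y> h' h'h] by blast
  qed
  moreover have "inverse_system \<X> \<Longrightarrow> sys_cone X \<X> p \<longleftrightarrow> sys_cone Y \<X> q"
    using sys_cone_precomp_iff q qp by blast
  ultimately show ?thesis
    unfolding hpol_expansion_def solvable_def by blast
qed

lemma hpol_expansion_precomp:
  fixes \<X> :: "('i, 'u) system"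
  assumes "hpol_expansion Y \<X> q"
  shows "hpol_expansion X \<X> (\<lambda>i. q i \<circ> \<mu>)"
proof -
  have q: "continuous_map Y (Obj \<X> i) (q i)" if "i \<in> Idx \<X>" for i
    using assms that by (simp add: hpol_expansion_def sys_cone_def)
  then have "sys_cone_eq X \<X> (\<lambda>i. q i \<circ> \<mu>) (\<lambda>i. q i \<circ> \<mu>)"
    using cont by (auto simp: sys_cone_eq_def intro: continuous_map_compose)
  then show ?thesis
    using hpol_expansion_iff[OF q] assms by blast
qed

lemma hpol_expansion_descends:
  fixes \<X> :: "('i, 'u) system"
  assumes p: "hpol_expansion X \<X> p"
  shows "\<exists>q. hpol_expansion Y \<X> q"
proof -
  have "inverse_system \<X>" "sys_cone X \<X> p"
    using p by (auto simp: hpol_expansion_def)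
  then obtain q where q: "\<And>i. i \<in> Idx \<X> \<Longrightarrow> continuous_map Y (Obj \<X> i) (q i)"
    and qp: "sys_cone_eq X \<X> (\<lambda>i. q i \<circ> \<mu>) p"
    by (rule continuous_family_lift) blast
  show ?thesis
    using hpol_expansion_iff[OF q qp] p by blast
qed

end


section \<open>Uniqueness of HPol-expansions\<close>

lemma inverse_system_upper_bound:
  assumes "inverse_system \<X>" "i \<in> Idx \<X>" "j \<in> Idx \<X>"
  obtains k where "k \<in> Idx \<X>" "Le \<X> i k" "Le \<X> j k"
proof -
  have "\<forall>i\<in>Idx \<X>. \<forall>j\<in>Idx \<X>. \<exists>k\<in>Idx \<X>. Le \<X> i k \<and> Le \<X> j k"
    using assms(1) unfolding inverse_system_def by (elim conjE)
  then show ?thesis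
    using assms(2-) that by blast
qed

lemma inverse_system_Le_trans:
  assumes "inverse_system \<X>" "i \<in> Idx \<X>" "j \<in> Idx \<X>" "k \<in> Idx \<X>" "Le \<X> i j" "Le \<X> j k"
  shows "Le \<X> i k"
proof -
  have "\<forall>i\<in>Idx \<X>. \<forall>j\<in>Idx \<X>. \<forall>k\<in>Idx \<X>. Le \<X> i j \<and> Le \<X> j k \<longrightarrow> Le \<X> i k"
    using assms(1) unfolding inverse_system_def by (elim conjE)
  then show ?thesis
    using assms(2-) by blast
qed

lemma inverse_system_Bond_comp:
  assumes "inverse_system \<X>" "i \<in> Idx \<X>" "j \<in> Idx \<X>" "k \<in> Idx \<X>" "Le \<X> i j" "Le \<X> j k"
  shows "homotopic (Obj \<X> k) (Obj \<X> i) (Bond \<X> i j \<circ> Bond \<X> j k) (Bond \<X> i k)"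
proof -
  have "\<forall>i\<in>Idx \<X>. \<forall>j\<in>Idx \<X>. \<forall>k\<in>Idx \<X>. Le \<X> i j \<and> Le \<X> j k \<longrightarrow>
      homotopic (Obj \<X> k) (Obj \<X> i) (Bond \<X> i j \<circ> Bond \<X> j k) (Bond \<X> i k)"
    using assms(1) unfolding inverse_system_def by (elim conjE)
  then show ?thesis
    using assms(2-) by blast
qed

text \<open>
  A homotopy at a stage \<open>l\<close> of the system pulls back along the bond from any later stage \<open>k\<close>. Homotopies
  that live at different stages can therefore be composed at a common upper bound, and this is how
  equations between morphisms of systems are chained below.
\<close>

lemma homotopic_at_later_stage:
  assumes \<X>: "inverse_system \<X>" and idx: "i \<in> Idx \<X>" "j \<in> Idx \<X>" "l \<in> Idx \<X>" "k \<in> Idx \<X>"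
    and le: "Le \<X> i l" "Le \<X> j l" "Le \<X> l k"
    and a: "continuous_map (Obj \<X> i) P a" and b: "continuous_map (Obj \<X> j) P b"
    and hom: "homotopic (Obj \<X> l) P (a \<circ> Bond \<X> i l) (b \<circ> Bond \<X> j l)"
  shows "homotopic (Obj \<X> k) P (a \<circ> Bond \<X> i k) (b \<circ> Bond \<X> j k)"
proof -
  have "homotopic (Obj \<X> k) P (a \<circ> (Bond \<X> i l \<circ> Bond \<X> l k)) (a \<circ> Bond \<X> i k)"
    using inverse_system_Bond_comp[OF \<X> idx(1,3,4) le(1,3)] a
    by (rule homotopic_with_compose_continuous_map_left) simp
  moreover have "homotopic (Obj \<X> k) P (b \<circ> (Bond \<X> j l \<circ> Bond \<X> l k)) (b \<circ> Bond \<X> j k)"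
    using inverse_system_Bond_comp[OF \<X> idx(2,3,4) le(2,3)] b
    by (rule homotopic_with_compose_continuous_map_left) simp
  moreover have "homotopic (Obj \<X> k) P (a \<circ> Bond \<X> i l \<circ> Bond \<X> l k) (b \<circ> Bond \<X> j l \<circ> Bond \<X> l k)"
    using hom inverse_system_Bond[OF \<X> idx(3,4) le(3)]
    by (rule homotopic_with_compose_continuous_map_right) simp
  ultimately show ?thesis
    unfolding o_assoc by (meson homotopic_with_trans homotopic_with_symD)
qed

lemma pro_eq_sym: "pro_eq \<X> \<Y> F G \<Longrightarrow> pro_eq \<X> \<Y> G F"
  unfolding pro_eq_def by (cases F; cases G) (auto, metis homotopic_with_symD)

lemma pro_eq_trans:
  assumes \<X>: "inverse_system \<X>"
    and F: "pro_map \<X> \<Y> F" and G: "pro_map \<X> \<Y> G" and H: "pro_map \<X> \<Y> H"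
    and FG: "pro_eq \<X> \<Y> F G" and GH: "pro_eq \<X> \<Y> G H"
  shows "pro_eq \<X> \<Y> F H"
proof -
  obtain \<phi> f \<psi> g \<omega> h where [simp]: "F = (\<phi>, f)" "G = (\<psi>, g)" "H = (\<omega>, h)"
    by (metis surj_pair)
  have "\<exists>k\<in>Idx \<X>. Le \<X> (\<phi> m) k \<and> Le \<X> (\<omega> m) k \<and>
      homotopic (Obj \<X> k) (Obj \<Y> m) (f m \<circ> Bond \<X> (\<phi> m) k) (h m \<circ> Bond \<X> (\<omega> m) k)"
    if m: "m \<in> Idx \<Y>" for m
  proof -
    have idx: "\<phi> m \<in> Idx \<X>" "\<psi> m \<in> Idx \<X>" "\<omega> m \<in> Idx \<X>"
      and cont: "continuous_map (Obj \<X> (\<phi> m)) (Obj \<Y> m) (f m)"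
        "continuous_map (Obj \<X> (\<psi> m)) (Obj \<Y> m) (g m)"
        "continuous_map (Obj \<X> (\<omega> m)) (Obj \<Y> m) (h m)"
      using F G H m by (auto simp: pro_map_def)
    obtain l where l: "l \<in> Idx \<X>" "Le \<X> (\<phi> m) l" "Le \<X> (\<psi> m) l"
      "homotopic (Obj \<X> l) (Obj \<Y> m) (f m \<circ> Bond \<X> (\<phi> m) l) (g m \<circ> Bond \<X> (\<psi> m) l)"
      using FG m by (auto simp: pro_eq_def)
    obtain l' where l': "l' \<in> Idx \<X>" "Le \<X> (\<psi> m) l'" "Le \<X> (\<omega> m) l'"
      "homotopic (Obj \<X> l') (Obj \<Y> m) (g m \<circ> Bond \<X> (\<psi> m) l') (h m \<circ> Bond \<X> (\<omega> m) l')"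
      using GH m by (auto simp: pro_eq_def)
    obtain k where k: "k \<in> Idx \<X>" "Le \<X> l k" "Le \<X> l' k"
      using inverse_system_upper_bound[OF \<X> l(1) l'(1)] .
    have "homotopic (Obj \<X> k) (Obj \<Y> m) (f m \<circ> Bond \<X> (\<phi> m) k) (h m \<circ> Bond \<X> (\<omega> m) k)"
      using homotopic_at_later_stage[OF \<X> idx(1,2) l(1) k(1) l(2,3) k(2) cont(1,2) l(4)]
        homotopic_at_later_stage[OF \<X> idx(2,3) l'(1) k(1) l'(2,3) k(3) cont(2,3) l'(4)]
      by (rule homotopic_with_trans)
    then show ?thesis
      using k inverse_system_Le_trans[OF \<X> idx(1) l(1) k(1) l(2) k(2)]
        inverse_system_Le_trans[OF \<X> idx(3) l'(1) k(1) l'(3) k(3)] by blast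
  qed
  then show ?thesis
    by (simp add: pro_eq_def)
qed

lemma pro_map_id:
  assumes \<X>: "inverse_system \<X>"
  shows "pro_map \<X> \<X> pro_id"
proof -
  have "\<exists>l\<in>Idx \<X>. Le \<X> m l \<and> Le \<X> n l \<and>
      homotopic (Obj \<X> l) (Obj \<X> m) (Bond \<X> m l) (Bond \<X> m n \<circ> Bond \<X> n l)"
    if m: "m \<in> Idx \<X>" and n: "n \<in> Idx \<X>" and le: "Le \<X> m n" for m n
  proof -
    have "Le \<X> n n"
      using \<X> n unfolding inverse_system_def by (elim conjE) (rule bspec)
    then show ?thesis
      using n le inverse_system_Bond_comp[OF \<X> m n n le] homotopic_with_symD by blast
  qed
  then show ?thesis
    by (simp add: pro_map_def pro_id_def)
qed

lemma pro_map_compatible: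
  assumes "pro_map \<X> \<Y> (\<phi>, f)" "m \<in> Idx \<Y>" "n \<in> Idx \<Y>" "Le \<Y> m n"
  obtains l where "l \<in> Idx \<X>" "Le \<X> (\<phi> m) l" "Le \<X> (\<phi> n) l"
    "homotopic (Obj \<X> l) (Obj \<Y> m)
      (f m \<circ> Bond \<X> (\<phi> m) l) (Bond \<Y> m n \<circ> f n \<circ> Bond \<X> (\<phi> n) l)"
proof -
  have "\<exists>l\<in>Idx \<X>. Le \<X> (\<phi> m) l \<and> Le \<X> (\<phi> n) l \<and> homotopic (Obj \<X> l) (Obj \<Y> m)
      (f m \<circ> Bond \<X> (\<phi> m) l) (Bond \<Y> m n \<circ> f n \<circ> Bond \<X> (\<phi> n) l)"
    using assms unfolding pro_map_def by simp
  then show ?thesis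
    using that by blast
qed

text \<open>
  Let \<open>F = (\<phi>, f)\<close> and \<open>G = (\<psi>, g)\<close>. For \<open>m \<le> n\<close> the components of the composite have to agree at some
  stage of \<open>\<X>\<close>. Those of \<open>G\<close> agree at a stage \<open>l\<close> of \<open>\<Y>\<close>. The compatibility of \<open>F\<close> with the bonds of \<open>\<Y>\<close>
  from \<open>l\<close> to \<open>\<psi> m\<close> and from \<open>l\<close> to \<open>\<psi> n\<close> holds from stages \<open>s\<close> and \<open>t\<close> of \<open>\<X>\<close> on, and an upper bound of \<open>s\<close>
  and \<open>t\<close> is the required stage.
\<close>

lemma pro_map_comp:
  assumes \<X>: "inverse_system \<X>" and \<Y>: "inverse_system \<Y>" and \<Z>: "inverse_system \<Z>"
    and F: "pro_map \<X> \<Y> F" and G: "pro_map \<Y> \<Z> G"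
  shows "pro_map \<X> \<Z> (pro_comp G F)"
proof -
  obtain \<phi> f \<psi> g where FG: "F = (\<phi>, f)" "G = (\<psi>, g)"
    by (metis surj_pair)
  note F = F[unfolded FG] and G = G[unfolded FG]
  note \<phi> = pro_map_component[OF F] and \<psi> = pro_map_component[OF G]
  have stage: "\<exists>s\<in>Idx \<X>. Le \<X> (\<phi> i) s \<and> Le \<X> (\<phi> l) s \<and>
      (\<forall>k\<in>Idx \<X>. Le \<X> s k \<longrightarrow> homotopic (Obj \<X> k) (Obj \<Y> i)
        (f i \<circ> Bond \<X> (\<phi> i) k) (Bond \<Y> i l \<circ> f l \<circ> Bond \<X> (\<phi> l) k))"
    if i: "i \<in> Idx \<Y>" and l: "l \<in> Idx \<Y>" and le: "Le \<Y> i l" for i l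
  proof -
    obtain s where s: "s \<in> Idx \<X>" "Le \<X> (\<phi> i) s" "Le \<X> (\<phi> l) s"
      "homotopic (Obj \<X> s) (Obj \<Y> i)
        (f i \<circ> Bond \<X> (\<phi> i) s) (Bond \<Y> i l \<circ> f l \<circ> Bond \<X> (\<phi> l) s)"
      using pro_map_compatible[OF F i l le] .
    have "continuous_map (Obj \<X> (\<phi> l)) (Obj \<Y> i) (Bond \<Y> i l \<circ> f l)"
      using \<phi>(2)[OF l] inverse_system_Bond[OF \<Y> i l le] by (rule continuous_map_compose)
    then show ?thesis
      using s homotopic_at_later_stage[OF \<X> \<phi>(1)[OF i] \<phi>(1)[OF l] s(1) _ s(2,3) _ \<phi>(2)[OF i] _ s(4)]
      by blast
  qed
  have "\<exists>k\<in>Idx \<X>. Le \<X> (\<phi> (\<psi> m)) k \<and> Le \<X> (\<phi> (\<psi> n)) k \<and> homotopic (Obj \<X> k) (Obj \<Z> m)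
      (g m \<circ> f (\<psi> m) \<circ> Bond \<X> (\<phi> (\<psi> m)) k)
      (Bond \<Z> m n \<circ> (g n \<circ> f (\<psi> n)) \<circ> Bond \<X> (\<phi> (\<psi> n)) k)"
    if m: "m \<in> Idx \<Z>" and n: "n \<in> Idx \<Z>" and le: "Le \<Z> m n" for m n
  proof -
    obtain l where l: "l \<in> Idx \<Y>" "Le \<Y> (\<psi> m) l" "Le \<Y> (\<psi> n) l"
      and g_hom: "homotopic (Obj \<Y> l) (Obj \<Z> m)
        (g m \<circ> Bond \<Y> (\<psi> m) l) (Bond \<Z> m n \<circ> g n \<circ> Bond \<Y> (\<psi> n) l)"
      using pro_map_compatible[OF G m n le] .
    obtain s where s: "s \<in> Idx \<X>" "Le \<X> (\<phi> (\<psi> m)) s" "Le \<X> (\<phi> l) s"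
      and s_hom: "\<And>k. k \<in> Idx \<X> \<Longrightarrow> Le \<X> s k \<Longrightarrow> homotopic (Obj \<X> k) (Obj \<Y> (\<psi> m))
        (f (\<psi> m) \<circ> Bond \<X> (\<phi> (\<psi> m)) k) (Bond \<Y> (\<psi> m) l \<circ> f l \<circ> Bond \<X> (\<phi> l) k)"
      using stage[OF \<psi>(1)[OF m] l(1,2)] by blast
    obtain t where t: "t \<in> Idx \<X>" "Le \<X> (\<phi> (\<psi> n)) t" "Le \<X> (\<phi> l) t"
      and t_hom: "\<And>k. k \<in> Idx \<X> \<Longrightarrow> Le \<X> t k \<Longrightarrow> homotopic (Obj \<X> k) (Obj \<Y> (\<psi> n))
        (f (\<psi> n) \<circ> Bond \<X> (\<phi> (\<psi> n)) k) (Bond \<Y> (\<psi> n) l \<circ> f l \<circ> Bond \<X> (\<phi> l) k)"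
      using stage[OF \<psi>(1)[OF n] l(1,3)] by blast
    obtain k where k: "k \<in> Idx \<X>" "Le \<X> s k" "Le \<X> t k"
      using inverse_system_upper_bound[OF \<X> s(1) t(1)] .
    have le_k: "Le \<X> (\<phi> (\<psi> m)) k" "Le \<X> (\<phi> (\<psi> n)) k" "Le \<X> (\<phi> l) k"
      using inverse_system_Le_trans[OF \<X>] \<phi>(1) \<psi>(1) m n l(1) s t k by blast+
    have fl: "continuous_map (Obj \<X> k) (Obj \<Y> l) (f l \<circ> Bond \<X> (\<phi> l) k)"
      using inverse_system_Bond[OF \<X> \<phi>(1)[OF l(1)] k(1) le_k(3)] \<phi>(2)[OF l(1)]
      by (rule continuous_map_compose)
    have "homotopic (Obj \<X> k) (Obj \<Z> m) (g m \<circ> (f (\<psi> m) \<circ> Bond \<X> (\<phi> (\<psi> m)) k))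
        (g m \<circ> (Bond \<Y> (\<psi> m) l \<circ> f l \<circ> Bond \<X> (\<phi> l) k))"
      using s_hom[OF k(1,2)] \<psi>(2)[OF m] by (rule homotopic_with_compose_continuous_map_left) simp
    moreover have "homotopic (Obj \<X> k) (Obj \<Z> m)
        (g m \<circ> Bond \<Y> (\<psi> m) l \<circ> (f l \<circ> Bond \<X> (\<phi> l) k))
        (Bond \<Z> m n \<circ> g n \<circ> Bond \<Y> (\<psi> n) l \<circ> (f l \<circ> Bond \<X> (\<phi> l) k))"
      using g_hom fl by (rule homotopic_with_compose_continuous_map_right) simp
    moreover have "homotopic (Obj \<X> k) (Obj \<Z> m)
        (Bond \<Z> m n \<circ> g n \<circ> (f (\<psi> n) \<circ> Bond \<X> (\<phi> (\<psi> n)) k))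
        (Bond \<Z> m n \<circ> g n \<circ> (Bond \<Y> (\<psi> n) l \<circ> f l \<circ> Bond \<X> (\<phi> l) k))"
      using t_hom[OF k(1,3)]
        continuous_map_compose[OF \<psi>(2)[OF n] inverse_system_Bond[OF \<Z> m n le]]
      by (rule homotopic_with_compose_continuous_map_left) simp
    ultimately have "homotopic (Obj \<X> k) (Obj \<Z> m)
        (g m \<circ> f (\<psi> m) \<circ> Bond \<X> (\<phi> (\<psi> m)) k)
        (Bond \<Z> m n \<circ> (g n \<circ> f (\<psi> n)) \<circ> Bond \<X> (\<phi> (\<psi> n)) k)"
      unfolding o_assoc by (meson homotopic_with_trans homotopic_with_symD)
    then show ?thesis
      using k(1) le_k by blast
  qed
  moreover have "continuous_map (Obj \<X> (\<phi> (\<psi> m))) (Obj \<Z> m) (g m \<circ> f (\<psi> m))"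
    if "m \<in> Idx \<Z>" for m
    using \<phi>(2)[OF \<psi>(1)[OF that]] \<psi>(2)[OF that] by (rule continuous_map_compose)
  ultimately show ?thesis
    using \<phi>(1) \<psi>(1) by (simp add: FG pro_map_def pro_comp_def)
qed

lemma sys_cone_comp_pro_comp:
  "sys_cone_comp (pro_comp G F) p = sys_cone_comp G (sys_cone_comp F p)"
  by (cases G; cases F) (simp add: sys_cone_comp_def pro_comp_def fun_eq_iff)

text \<open>
  Both \<open>F\<close> and the identity solve the universal problem that \<open>p\<close> poses as a cone over its own
  system.
\<close>

lemma hpol_expansion_endomorphism:
  fixes \<X> :: "('i, 'u) system"
  assumes p: "hpol_expansion X \<X> p"
    and F: "pro_map \<X> \<X> F" and Fp: "sys_cone_eq X \<X> (sys_cone_comp F p) p"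
  shows "pro_eq \<X> \<X> F pro_id"
proof -
  have \<X>: "inverse_system \<X>" and cone: "sys_cone X \<X> p"
    using p by (auto simp: hpol_expansion_def)
  obtain E where E: "pro_map \<X> \<X> E"
    and uniq: "\<And>G. \<lbrakk>pro_map \<X> \<X> G; sys_cone_eq X \<X> (sys_cone_comp G p) p\<rbrakk> \<Longrightarrow> pro_eq \<X> \<X> E G"
    using p \<X> cone unfolding hpol_expansion_def by blast
  have "sys_cone_eq X \<X> (sys_cone_comp pro_id p) p"
    using cone by (simp add: sys_cone_eq_def sys_cone_comp_def pro_id_def sys_cone_def)
  then have "pro_eq \<X> \<X> E pro_id"
    using uniq pro_map_id[OF \<X>] by blast
  then show ?thesis
    using pro_eq_trans[OF \<X> F E pro_map_id[OF \<X>]] pro_eq_sym[OF uniq[OF F Fp]] by blast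
qed

lemma hpol_expansions_pro_isomorphic:
  fixes \<X> \<Y> :: "('i, 'u) system"
  assumes p: "hpol_expansion X \<X> p" and q: "hpol_expansion X \<Y> q"
  shows "pro_isomorphic \<X> \<Y>"
proof -
  have \<X>: "inverse_system \<X>" "sys_cone X \<X> p" and \<Y>: "inverse_system \<Y>" "sys_cone X \<Y> q"
    using p q by (auto simp: hpol_expansion_def)
  obtain F where F: "pro_map \<X> \<Y> F" "sys_cone_eq X \<Y> (sys_cone_comp F p) q"
    using p \<Y> unfolding hpol_expansion_def by blast
  obtain G where G: "pro_map \<Y> \<X> G" "sys_cone_eq X \<X> (sys_cone_comp G q) p"
    using q \<X> unfolding hpol_expansion_def by blast
  have "sys_cone_eq X \<X> (sys_cone_comp (pro_comp G F) p) p"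
    using sys_cone_eq_trans[OF sys_cone_comp_cong[OF G(1) F(2)] G(2)]
    by (simp add: sys_cone_comp_pro_comp)
  then have GF: "pro_eq \<X> \<X> (pro_comp G F) pro_id"
    by (rule hpol_expansion_endomorphism[OF p pro_map_comp[OF \<X>(1) \<Y>(1) \<X>(1) F(1) G(1)]])
  have "sys_cone_eq X \<Y> (sys_cone_comp (pro_comp F G) q) q"
    using sys_cone_eq_trans[OF sys_cone_comp_cong[OF F(1) G(2)] F(2)]
    by (simp add: sys_cone_comp_pro_comp)
  then have "pro_eq \<Y> \<Y> (pro_comp F G) pro_id"
    by (rule hpol_expansion_endomorphism[OF q pro_map_comp[OF \<Y>(1) \<X>(1) \<Y>(1) G(1) F(1)]])
  then show ?thesis
    using F(1) G(1) GF unfolding pro_isomorphic_def by blast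
qed


section \<open>The shape of the Hausdorff reflection\<close>

lemma (in hpol_equivalence) same_shape: "same_shape TYPE('u \<times> 'i) X Y"
  unfolding same_shape_def
  using hpol_expansion_precomp hpol_expansion_descends hpol_expansions_pro_isomorphic by blast

theorem corollary3:
  fixes X :: "'a topology"
  shows "same_shape TYPE('u \<times> 'i) X (hausdorff_reflection X)"
  by (rule hpol_equivalence.same_shape[OF hpol_equivalence_reflection_map])

end
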